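(* Let $\mathcal X\subset\mathbb R^d$ be nonempty and compact, let $\ell:\mathcal X\times\Xi\to\mathbb R$ be a loss function, and suppose there is a measurable $M:\Xi\to\mathbb R_+$ such that for all $\xi\in\Xi$ the function $\ell(\cdot;\xi)$ is $M(\xi)$-Lipschitz on $\mathcal X$ with respect to some norm $\|\cdot\|$. Assume $\mathbb E_{P_0}[M(\xi)^2]<\infty$ and $\mathbb E_{P_0}[|\ell(x_0;\xi)|^2]<\infty$ for some $x_0\in\mathcal X$. Let $f$ satisfy the smoothness assumption in the context, and let $\rho>0$. If $\xi_1,\xi_2,\dots$ are i.i.d. with distribution $P_0$ and $\widehat P_n$ is the empirical distribution of $\xi_1,\dots,\xi_n$, then $$\sup_{P\ll\widehat P_n:\,D_f(P\|\widehat P_n)\le \rho/n}\mathbb E_P[\ell(x;\xi)]=\mathbb E_{\widehat P_n}[\ell(x;\xi)]+\sqrt{\frac{\rho}{n}\operatorname{Var}_{\widehat P_n}(\ell(x;\xi))}+\varepsilon_n(x),$$ where $\sup_{x\in\mathcal X}\sqrt n\,|\varepsilon_n(x)|\to0$ in outer probability as $n\to\infty$.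
   Context: $(\Xi,\mathcal A,P_0)$ is a probability space with $\Xi$ a subset of a separable metric space; $\ell(x;\cdot)$ is measurable for each $x$. Smoothness assumption on $f$: $f:[0,\infty)\to\mathbb R\cup\{+\infty\}$ is lower semicontinuous and convex, three times differentiable in a neighborhood of $1$, with $f(1)=f'(1)=0$ and $f''(1)=2$. For probability measures $P\ll Q$, $D_f(P\|Q)=\int f\!\left(\frac{dP}{dQ}\right)dQ$. $\operatorname{Var}_{\widehat P_n}(h)=\mathbb E_{\widehat P_n}[h^2]-\mathbb E_{\widehat P_n}[h]^2$. *)

theory Defs
  imports "HOL-Probability.Probability"
begin

text \<open>Lower semicontinuity and convexity of an extended-real-valued function on a set.\<close>

definition lsc_on :: "'a::topological_space set \<Rightarrow> ('a \<Rightarrow> ereal) \<Rightarrow> bool" where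
  "lsc_on S f \<longleftrightarrow> (\<forall>x\<in>S. f x \<le> Liminf (at x within S) f)"

definition ereal_convex_on :: "'a::real_vector set \<Rightarrow> ('a \<Rightarrow> ereal) \<Rightarrow> bool" where
  "ereal_convex_on S f \<longleftrightarrow> convex S \<and>
     (\<forall>x\<in>S. \<forall>y\<in>S. \<forall>t. 0 < t \<and> t < 1 \<longrightarrow>
        f ((1 - t) *\<^sub>R x + t *\<^sub>R y) \<le> ereal (1 - t) * f x + ereal t * f y)"

text \<open>
  A divergence generator is a function from [0, infinity) to the reals together with
  +infinity; its values at negative arguments are irrelevant. Near 1 it is finite, and there
  the derivatives are those of its real-valued version.
\<close>

definition smooth_divergence_fun :: "(real \<Rightarrow> ereal) \<Rightarrow> bool" where
  "smooth_divergence_fun f \<longleftrightarrow>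
     (\<forall>t\<ge>0. f t \<noteq> -\<infinity>) \<and>
     lsc_on {0..} f \<and>
     ereal_convex_on {0..} f \<and>
     (\<forall>\<^sub>F t in nhds 1. \<bar>f t\<bar> \<noteq> \<infinity> \<and>
        (\<forall>k<3. (deriv ^^ k) (\<lambda>s. real_of_ereal (f s)) differentiable (at t))) \<and>
     f 1 = 0 \<and>
     deriv (\<lambda>s. real_of_ereal (f s)) 1 = 0 \<and>
     (deriv ^^ 2) (\<lambda>s. real_of_ereal (f s)) 1 = 2"

text \<open>
  The integral of an extended-real-valued function, as the difference of the integrals of its
  positive and negative parts (\<^const>\<open>e2ennreal\<close> maps negative arguments to 0).
\<close>

definition ereal_integral :: "'a measure \<Rightarrow> ('a \<Rightarrow> ereal) \<Rightarrow> ereal" where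
  "ereal_integral Q g =
     enn2ereal (\<integral>\<^sup>+ z. e2ennreal (g z) \<partial>Q) - enn2ereal (\<integral>\<^sup>+ z. e2ennreal (- g z) \<partial>Q)"

text \<open>
  The divergence of P from Q; meaningful for probability measures on the same
  sigma-algebra with P absolutely continuous with respect to Q.
\<close>

definition f_divergence :: "(real \<Rightarrow> ereal) \<Rightarrow> 'a measure \<Rightarrow> 'a measure \<Rightarrow> ereal" where
  "f_divergence f P Q = ereal_integral Q (\<lambda>z. f (enn2real (RN_deriv Q P z)))"

definition divergence_ball :: "(real \<Rightarrow> ereal) \<Rightarrow> 'a measure \<Rightarrow> real \<Rightarrow> 'a measure set" where
  "divergence_ball f Q r =
     {P. prob_space P \<and> sets P = sets Q \<and> absolutely_continuous Q P \<and>
         f_divergence f P Q \<le> ereal r}"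

text \<open>
  The empirical distribution of \<open>z 0, \<dots>, z (n - 1)\<close>, on the measurable space of \<open>S\<close>.
\<close>

definition empirical_measure :: "'a measure \<Rightarrow> nat \<Rightarrow> (nat \<Rightarrow> 'a) \<Rightarrow> 'a measure" where
  "empirical_measure S n z = distr (uniform_count_measure {..<n}) S z"

definition variance_under :: "'a measure \<Rightarrow> ('a \<Rightarrow> real) \<Rightarrow> real" where
  "variance_under Q h = (\<integral>z. (h z)\<^sup>2 \<partial>Q) - (\<integral>z. h z \<partial>Q)\<^sup>2"

text \<open>An arbitrary norm on a real vector space, not necessarily the one of its type class.\<close>

definition is_norm :: "('a::real_vector \<Rightarrow> real) \<Rightarrow> bool" where
  "is_norm N \<longleftrightarrow>
     (\<forall>x. 0 \<le> N x) \<and> (\<forall>x. N x = 0 \<longleftrightarrow> x = 0) \<and>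
     (\<forall>a x. N (a *\<^sub>R x) = \<bar>a\<bar> * N x) \<and> (\<forall>x y. N (x + y) \<le> N x + N y)"

text \<open>
  Convergence to 0 in outer probability of nonnegative, not necessarily measurable,
  extended-real-valued maps.
\<close>

definition tendsto_zero_in_outer_prob :: "'w measure \<Rightarrow> (nat \<Rightarrow> 'w \<Rightarrow> ereal) \<Rightarrow> bool" where
  "tendsto_zero_in_outer_prob M Y \<longleftrightarrow>
     (\<forall>\<delta>>0. (\<lambda>n. outer_measure_of M {\<omega> \<in> space M. ereal \<delta> < Y n \<omega>}) \<longlonglongrightarrow> 0)"

end

theory Submission
  imports Defs
begin

text \<open>
  Fix a probability measure \<open>Q\<close>, and let \<open>h\<close> stay within \<open>b\<close> of its \<open>Q\<close>-mean. By Taylor expansion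
  \<open>f (1 + u)\<close> lies between \<open>(1 - \<eta>) u\<^sup>2\<close> and \<open>(1 + \<eta>) u\<^sup>2\<close> for \<open>\<bar>u\<bar> \<le> \<delta>\<close>, and by convexity
  \<open>f (1 + u) \<ge> (1 - \<eta>) \<delta> \<bar>u\<bar>\<close> beyond. So for a density \<open>1 + u\<close> in the ball of radius \<open>r\<close>, Cauchy-Schwarz
  bounds the contribution of \<open>\<bar>u\<bar> \<le> \<delta>\<close> to the gain by \<open>sqrt (r Var h / (1 - \<eta>))\<close>, and the rest
  contributes at most \<open>b r / ((1 - \<eta>) \<delta>)\<close>. Conversely, the density \<open>1 + t (h - E h)\<close> with \<open>t\<close> proportional
  to \<open>sqrt (r / Var h)\<close> is almost optimal; it is admissible unless \<open>Var h\<close> is so small that \<open>Q\<close> itself will do.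
  With \<open>r = \<rho> / n\<close>, the error multiplied by \<open>sqrt n\<close> is thus of order \<open>\<eta> sqrt Var + b / (\<delta> sqrt n)\<close>.
  Compactness and the Lipschitz condition give a square-integrable envelope \<open>H\<close> of all \<open>l x\<close>, and uniformity
  in \<open>x\<close> only requires that the empirical mean of \<open>H\<^sup>2\<close> is bounded in probability (Markov) and that
  \<open>max\<^bsub>i<n\<^esub> H (\<xi>\<^sub>i) / sqrt n\<close> tends to 0 in probability (union bound).
\<close>

section \<open>Growth of the divergence generator\<close>

text \<open>Second-order Taylor expansion at 1: the value and the first derivative vanish there, so
  \<open>f (1 + u)\<close> is half the second derivative at an intermediate point times
  \<open>u\<^sup>2\<close>. Existence of the third derivative makes the second one continuous at 1,
  hence close to 2 nearby.\<close>

lemma smooth_divergence_fun_near_one: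
  fixes f :: "real \<Rightarrow> ereal"
  assumes f: "smooth_divergence_fun f" and \<eta>: "0 < \<eta>"
  obtains \<delta> where "0 < \<delta>" "\<delta> < 1"
    "\<And>u. \<bar>u\<bar> \<le> \<delta> \<Longrightarrow> ereal ((1 - \<eta>) * u\<^sup>2) \<le> f (1 + u) \<and> f (1 + u) \<le> ereal ((1 + \<eta>) * u\<^sup>2)"
proof -
  define g where "g = (\<lambda>s. real_of_ereal (f s))"
  define D where "D k = (deriv ^^ k) g" for k
  have "\<forall>\<^sub>F t in nhds 1. \<bar>f t\<bar> \<noteq> \<infinity> \<and> (\<forall>k<3. D k differentiable (at t))"
    using f by (simp add: smooth_divergence_fun_def D_def g_def)
  then obtain d where "d > 0"
    and d: "\<And>t. dist t 1 < d \<Longrightarrow> \<bar>f t\<bar> \<noteq> \<infinity> \<and> (\<forall>k<3. D k differentiable (at t))"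
    unfolding eventually_nhds_metric by (metis (no_types, lifting))
  have deriv: "(D k has_real_derivative D (Suc k) t) (at t)" if "dist t 1 < d" "k < 3" for t k
    using d[OF that(1)] that(2) by (simp add: D_def DERIV_deriv_iff_real_differentiable)
  have "isCont (D 2) 1"
    using deriv[of 1 2] \<open>d > 0\<close> by (intro DERIV_isCont) auto
  have D1: "D 0 1 = 0" "D 1 1 = 0" "D 2 1 = 2"
    using f by (simp_all add: smooth_divergence_fun_def D_def g_def)
  from \<open>isCont (D 2) 1\<close> obtain e where "e > 0" and e: "\<And>t. dist t 1 < e \<Longrightarrow> \<bar>D 2 t - 2\<bar> < 2 * \<eta>"
    unfolding continuous_at_eps_delta D1 dist_real_def using \<eta>
    by (metis mult_pos_pos zero_less_numeral)
  \<comment> \<open>Halving keeps \<open>\<delta>\<close> strictly inside both neighbourhoods, and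
    the cap 1/2 keeps it below 1.\<close>
  define \<delta> where "\<delta> = min (1/2) (min d e / 2)"
  have \<delta>: "0 < \<delta>" "\<delta> < 1" "\<delta> < d" "\<delta> < e"
    using \<open>d > 0\<close> \<open>e > 0\<close> by (auto simp: \<delta>_def)
  show thesis
  proof (rule that[OF \<delta>(1,2)])
    fix u :: real assume u: "\<bar>u\<bar> \<le> \<delta>"
    have "(1 - \<eta>) * u\<^sup>2 \<le> g (1 + u) \<and> g (1 + u) \<le> (1 + \<eta>) * u\<^sup>2"
    proof (cases "u = 0")
      case True
      then show ?thesis using D1 by (simp add: D_def)
    next
      case False
      have "\<exists>t. (if 1 + u < 1 then 1 + u < t \<and> t < 1 else 1 < t \<and> t < 1 + u) \<and>
          g (1 + u) = (\<Sum>m<2. D m 1 / fact m * (1 + u - 1) ^ m) + D 2 t / fact 2 * (1 + u - 1) ^ 2"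
        using u \<delta> False
        by (intro Taylor[of 2 D g "1 - \<delta>" "1 + \<delta>"]) (auto simp: D_def[of 0] dist_real_def intro!: deriv)
      then obtain t where "if 1 + u < 1 then 1 + u < t \<and> t < 1 else 1 < t \<and> t < 1 + u"
        and "g (1 + u) = (\<Sum>m<2. D m 1 / fact m * (1 + u - 1) ^ m) + D 2 t / fact 2 * (1 + u - 1) ^ 2"
        by blast
      then have t: "\<bar>t - 1\<bar> < \<bar>u\<bar>" and gt: "g (1 + u) = D 2 t / 2 * u\<^sup>2"
        using D1 by (simp_all add: numeral_2_eq_2 split: if_splits)
      have "\<bar>D 2 t - 2\<bar> < 2 * \<eta>"
        using t u \<delta> by (intro e) (simp add: dist_real_def)
      then have "1 - \<eta> \<le> D 2 t / 2" "D 2 t / 2 \<le> 1 + \<eta>" by linarith+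
      then show ?thesis unfolding gt by (intro conjI mult_right_mono) auto
    qed
    moreover have "f (1 + u) = ereal (g (1 + u))"
      unfolding g_def using d[of "1 + u"] u \<delta> by (simp add: dist_real_def ereal_real')
    ultimately show "ereal ((1 - \<eta>) * u\<^sup>2) \<le> f (1 + u) \<and> f (1 + u) \<le> ereal ((1 + \<eta>) * u\<^sup>2)"
      by simp
  qed
qed

text \<open>Beyond distance \<open>\<delta>\<close>, convexity compares \<open>f t\<close> with the
  value at distance \<open>\<delta>\<close> on the segment from 1 to \<open>t\<close>: since
  \<open>f 1 = 0\<close>, \<open>f t\<close> is at least \<open>c * \<delta>\<^sup>2\<close> divided
  by the fraction \<open>\<delta> / \<bar>t - 1\<bar>\<close>, which is linear in the distance. The
  minimum joins the quadratic and the linear regime in one Huber-like bound.\<close>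

lemma smooth_divergence_fun_growth:
  fixes f :: "real \<Rightarrow> ereal"
  assumes f: "smooth_divergence_fun f" and \<delta>: "0 < \<delta>" "\<delta> < 1"
    and near: "\<And>u. \<bar>u\<bar> \<le> \<delta> \<Longrightarrow> ereal (c * u\<^sup>2) \<le> f (1 + u)"
    and c: "0 \<le> c" and t: "0 \<le> t"
  shows "ereal (c * min ((t - 1)\<^sup>2) (\<delta> * \<bar>t - 1\<bar>)) \<le> f t"
proof (cases "\<bar>t - 1\<bar> \<le> \<delta>")
  case True
  have "ereal (c * min ((t - 1)\<^sup>2) (\<delta> * \<bar>t - 1\<bar>)) \<le> ereal (c * (t - 1)\<^sup>2)"
    using c by (simp add: mult_left_mono)
  also have "\<dots> \<le> f t" using near[OF True] by simp
  finally show ?thesis .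
next
  case False
  define \<tau> where "\<tau> = \<delta> / \<bar>t - 1\<bar>"
  define u where "u = \<tau> * (t - 1)"
  have \<tau>: "0 < \<tau>" "\<tau> < 1" using False \<delta> by (auto simp: \<tau>_def)
  have u: "\<bar>u\<bar> = \<delta>" using False \<delta> by (auto simp: u_def \<tau>_def abs_mult)
  have "ereal_convex_on {0..} f" "f 1 = 0" "f t \<noteq> -\<infinity>"
    using f t by (auto simp: smooth_divergence_fun_def)
  have "f ((1 - \<tau>) *\<^sub>R 1 + \<tau> *\<^sub>R t) \<le> ereal (1 - \<tau>) * f 1 + ereal \<tau> * f t"
    using \<open>ereal_convex_on {0..} f\<close> \<tau> t unfolding ereal_convex_on_def
    by (meson atLeast_iff zero_le_one)
  then have "f ((1 - \<tau>) *\<^sub>R 1 + \<tau> *\<^sub>R t) \<le> ereal \<tau> * f t"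
    using \<open>f 1 = 0\<close> by simp
  moreover have eq: "(1 - \<tau>) *\<^sub>R 1 + \<tau> *\<^sub>R t = 1 + u" by (simp add: u_def algebra_simps)
  moreover have "ereal (c * u\<^sup>2) \<le> f (1 + u)" using u by (intro near) simp
  ultimately have le: "ereal (c * u\<^sup>2) \<le> ereal \<tau> * f t" unfolding eq by order
  show ?thesis
  proof (cases "f t")
    case (real y)
    have "c * \<delta>\<^sup>2 \<le> \<tau> * y" using le real u by (metis ereal_less_eq(3) power2_abs times_ereal.simps(1))
    then have "c * (\<delta> * \<bar>t - 1\<bar>) \<le> y"
      using False \<delta> by (simp add: \<tau>_def field_simps power2_eq_square)
    moreover have "c * min ((t - 1)\<^sup>2) (\<delta> * \<bar>t - 1\<bar>) \<le> c * (\<delta> * \<bar>t - 1\<bar>)"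
      using c by (intro mult_left_mono) auto
    ultimately show ?thesis using real by simp
  qed (use \<open>f t \<noteq> -\<infinity>\<close> in auto)
qed

section \<open>Robust expectation over a small divergence ball\<close>

text \<open>A nonnegative real minorant \<open>g\<close> of \<open>f\<close> turns the
  extended-valued divergence constraint into a bound on an ordinary integral of the density
  \<open>p\<close>, the form in which membership in the ball is exploited.\<close>

lemma divergence_ball_density:
  assumes Q: "prob_space Q" and P: "P \<in> divergence_ball f Q r"
    and g: "\<And>t. 0 \<le> t \<Longrightarrow> 0 \<le> g t \<and> ereal (g t) \<le> f t"
    and [measurable]: "g \<in> borel_measurable borel"
    and r: "0 \<le> r"
  defines "p \<equiv> \<lambda>z. enn2real (RN_deriv Q P z)"
  shows "integrable Q p" and "(\<integral>z. p z \<partial>Q) = 1"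
    and "h \<in> borel_measurable Q \<Longrightarrow> (\<integral>z. h z \<partial>P) = (\<integral>z. p z * h z \<partial>Q)"
    and "integrable Q (\<lambda>z. g (p z))" and "(\<integral>z. g (p z) \<partial>Q) \<le> r"
proof -
  interpret Q: prob_space Q by fact
  have P': "prob_space P" "sets P = sets Q" "absolutely_continuous Q P"
    and div: "f_divergence f P Q \<le> ereal r"
    using P by (auto simp: divergence_ball_def)
  interpret P: prob_space P by fact
  note RN = Q.RN_deriv_integral[OF P.sigma_finite_measure_axioms P'(3,2)]
    Q.RN_deriv_integrable[OF P.sigma_finite_measure_axioms P'(3,2)]
  show "integrable Q p" using RN(2)[of "\<lambda>_. 1"] by (simp add: p_def)
  show "(\<integral>z. p z \<partial>Q) = 1" using RN(1)[of "\<lambda>_. 1"] by (simp add: p_def P.prob_space)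
  show "h \<in> borel_measurable Q \<Longrightarrow> (\<integral>z. h z \<partial>P) = (\<integral>z. p z * h z \<partial>Q)"
    using RN(1)[of h] by (simp add: p_def)
  have [measurable]: "p \<in> borel_measurable Q" by (simp add: p_def)
  have p0: "0 \<le> p z" for z by (simp add: p_def)
  \<comment> \<open>The negative part vanishes, so \<open>ereal_integral\<close> reduces to a single
    nonnegative integral.\<close>
  have "e2ennreal (- f (p z)) = 0" for z
  proof -
    have "0 \<le> f (p z)" using g[OF p0] by (metis ereal_less_eq(5) order_trans)
    then show ?thesis by (simp add: e2ennreal_neg)
  qed
  then have "enn2ereal (\<integral>\<^sup>+z. e2ennreal (f (p z)) \<partial>Q) \<le> ereal r"
    using div by (simp add: f_divergence_def ereal_integral_def p_def zero_ennreal.rep_eq)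
  then have "e2ennreal (enn2ereal (\<integral>\<^sup>+z. e2ennreal (f (p z)) \<partial>Q)) \<le> e2ennreal (ereal r)"
    by (rule e2ennreal_mono)
  then have "(\<integral>\<^sup>+z. e2ennreal (f (p z)) \<partial>Q) \<le> ennreal r"
    by simp
  moreover have "(\<integral>\<^sup>+z. ennreal (g (p z)) \<partial>Q) \<le> (\<integral>\<^sup>+z. e2ennreal (f (p z)) \<partial>Q)"
    by (intro nn_integral_mono) (metis e2ennreal_ereal e2ennreal_mono g p0)
  ultimately have le: "(\<integral>\<^sup>+z. ennreal (g (p z)) \<partial>Q) \<le> ennreal r" by (rule order_trans[rotated])
  have g0: "AE z in Q. 0 \<le> g (p z)" using g p0 by simp
  show int: "integrable Q (\<lambda>z. g (p z))"
    using le g0 by (intro integrableI_nonneg) (auto simp: le_less_trans less_top[symmetric] top_unique)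
  show "(\<integral>z. g (p z) \<partial>Q) \<le> r"
    using le r by (simp add: nn_integral_eq_integral[OF int g0])
qed

text \<open>For \<open>\<bar>u\<bar> \<le> \<delta>\<close> this is Young's inequality with weight
  \<open>c\<close>; beyond, \<open>\<bar>u * v\<bar> \<le> b * \<bar>u\<bar>\<close>. All terms are
  nonnegative, so the sum of the two bounds covers both regimes. Optimizing \<open>c\<close> after
  integration has the effect of Cauchy-Schwarz.\<close>

lemma mult_le_truncated_square:
  fixes u :: real
  assumes "0 < \<delta>" "0 < c" "\<bar>v\<bar> \<le> b"
  shows "u * v \<le> (c / 2 + b / \<delta>) * min (u\<^sup>2) (\<delta> * \<bar>u\<bar>) + v\<^sup>2 / (2 * c)"
proof (cases "\<bar>u\<bar> \<le> \<delta>")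
  case True
  have "0 \<le> (c * u - v)\<^sup>2 / (2 * c)" using assms by simp
  also have "\<dots> = c / 2 * u\<^sup>2 + v\<^sup>2 / (2 * c) - u * v"
    using assms by (simp add: field_simps power2_eq_square)
  finally have "u * v \<le> c / 2 * u\<^sup>2 + v\<^sup>2 / (2 * c)" by simp
  moreover have "0 \<le> b / \<delta> * u\<^sup>2" using assms by simp
  moreover have "min (u\<^sup>2) (\<delta> * \<bar>u\<bar>) = u\<^sup>2"
    using True by (simp add: min_def) (metis abs_ge_zero mult_right_mono power2_abs power2_eq_square)
  ultimately show ?thesis by (simp add: distrib_right)
next
  case False
  then have m: "min (u\<^sup>2) (\<delta> * \<bar>u\<bar>) = \<delta> * \<bar>u\<bar>"
    using mult_right_mono[of \<delta> "\<bar>u\<bar>" "\<bar>u\<bar>"] by (simp add: min_def power2_eq_square)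
  have "u * v \<le> \<bar>u\<bar> * \<bar>v\<bar>" by (metis abs_ge_self abs_mult)
  also have "\<dots> \<le> \<bar>u\<bar> * b" using assms by (intro mult_left_mono) auto
  also have "\<dots> = b / \<delta> * (\<delta> * \<bar>u\<bar>)" using assms by simp
  finally have "u * v \<le> b / \<delta> * (\<delta> * \<bar>u\<bar>)" .
  moreover have "0 \<le> c / 2 * (\<delta> * \<bar>u\<bar>)" "0 \<le> v\<^sup>2 / (2 * c)" using assms by auto
  ultimately show ?thesis unfolding m by (simp add: distrib_right)
qed

text \<open>Whatever real value the Bochner integral \<open>expectation h\<close> takes, the
  hypothesis makes \<open>h\<close> essentially bounded; square-integrability and the centred form
  of the variance follow.\<close>

lemma (in prob_space) variance_under_eq:
  assumes [measurable]: "h \<in> borel_measurable M" and "AE z in M. \<bar>h z - expectation h\<bar> \<le> b"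
  shows "integrable M h" and "integrable M (\<lambda>z. (h z)\<^sup>2)"
    and "variance_under M h = (\<integral>z. (h z - expectation h)\<^sup>2 \<partial>M)"
proof -
  have bd: "AE z in M. \<bar>h z\<bar> \<le> b + \<bar>expectation h\<bar>" using assms(2) by eventually_elim linarith
  then show 1: "integrable M h"
    by (intro integrable_const_bound[where B = "b + \<bar>expectation h\<bar>"]) auto
  have "AE z in M. norm ((h z)\<^sup>2) \<le> (b + \<bar>expectation h\<bar>)\<^sup>2"
    using bd by eventually_elim (simp add: abs_le_square_iff[symmetric])
  then show 2: "integrable M (\<lambda>z. (h z)\<^sup>2)"
    by (intro integrable_const_bound) auto
  show "variance_under M h = (\<integral>z. (h z - expectation h)\<^sup>2 \<partial>M)"
    using variance_eq[OF 1 2] by (simp add: variance_under_def)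
qed

text \<open>With \<open>p\<close> the density of \<open>P\<close>, the gain over \<open>Q\<close> is
  the integral of \<open>(p - 1) * (h - m)\<close>. The truncated square of \<open>p - 1\<close> has
  integral at most \<open>R = r / (1 - \<eta>)\<close>, so the pointwise product bound yields
  \<open>(c / 2 + b / \<delta>) * R + s\<^sup>2 / (2 * c)\<close> for every
  \<open>c > 0\<close>.\<close>

lemma divergence_ball_integral_le:
  assumes Q: "prob_space Q" and P: "P \<in> divergence_ball f Q r"
    and f_ge: "\<And>t. 0 \<le> t \<Longrightarrow> ereal ((1 - \<eta>) * min ((t - 1)\<^sup>2) (\<delta> * \<bar>t - 1\<bar>)) \<le> f t"
    and \<eta>: "\<eta> < 1" and \<delta>: "0 < \<delta>" and r: "0 < r"
    and [measurable]: "h \<in> borel_measurable Q"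
    and h: "AE z in Q. \<bar>h z - (\<integral>z. h z \<partial>Q)\<bar> \<le> b"
  shows "(\<integral>z. h z \<partial>P) \<le>
    (\<integral>z. h z \<partial>Q) + sqrt (r / (1 - \<eta>) * variance_under Q h) + b / \<delta> * (r / (1 - \<eta>))"
proof -
  interpret Q: prob_space Q by fact
  define m where "m = (\<integral>z. h z \<partial>Q)"
  define p where "p z = enn2real (RN_deriv Q P z)" for z
  define q where "q z = min ((p z - 1)\<^sup>2) (\<delta> * \<bar>p z - 1\<bar>)" for z
  define R where "R = r / (1 - \<eta>)"
  define s where "s = sqrt (variance_under Q h)"
  have R: "0 < R" using \<eta> r by (simp add: R_def)
  have "0 \<le> (1 - \<eta>) * min ((t - 1)\<^sup>2) (\<delta> * \<bar>t - 1\<bar>)" for t using \<eta> \<delta> by simp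
  note D = divergence_ball_density[OF Q P conjI[OF this f_ge], folded p_def]
  have int_p: "integrable Q p" and p1: "(\<integral>z. p z \<partial>Q) = 1"
    and hP: "(\<integral>z. h z \<partial>P) = (\<integral>z. p z * h z \<partial>Q)"
    and int_q: "integrable Q q" and "(1 - \<eta>) * (\<integral>z. q z \<partial>Q) \<le> r"
    using D \<eta> r by (simp_all flip: q_def)
  then have q_le: "(\<integral>z. q z \<partial>Q) \<le> R" using \<eta> by (simp add: R_def field_simps)
  have b: "0 \<le> b"
  proof -
    \<comment> \<open>A probability measure is nonzero, so an almost sure property holds at some
      point.\<close>
    have "\<exists>z. \<bar>h z - m\<bar> \<le> b" using eventually_happens'[OF Q.ae_filter_bot h] by (auto simp: m_def)
    then show ?thesis by auto
  qed
  note var = Q.variance_under_eq[OF _ h, simplified, folded m_def]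
  have var_int: "integrable Q (\<lambda>z. (h z - m)\<^sup>2)"
    using var(1,2) by (simp add: power2_diff)
  have s2: "variance_under Q h = s\<^sup>2" "0 \<le> s"
    unfolding s_def var(3) by simp_all
  have int_ph: "integrable Q (\<lambda>z. (p z - 1) * (h z - m))"
  proof (rule Bochner_Integration.integrable_bound)
    show "integrable Q (\<lambda>z. b * (p z - 1))" using int_p by simp
    show "AE z in Q. norm ((p z - 1) * (h z - m)) \<le> norm (b * (p z - 1))"
      using h unfolding m_def[symmetric]
      by eventually_elim (use b in \<open>simp add: abs_mult mult.commute mult_right_mono\<close>)
  qed (use int_p in \<open>auto dest: borel_measurable_integrable\<close>)
  have bound: "(\<integral>z. (p z - 1) * (h z - m) \<partial>Q) \<le> (c / 2 + b / \<delta>) * R + s\<^sup>2 / (2 * c)" if "0 < c" for c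
  proof -
    have "(\<integral>z. (p z - 1) * (h z - m) \<partial>Q) \<le> (\<integral>z. (c / 2 + b / \<delta>) * q z + (h z - m)\<^sup>2 / (2 * c) \<partial>Q)"
    proof (rule integral_mono_AE[OF int_ph])
      show "integrable Q (\<lambda>z. (c / 2 + b / \<delta>) * q z + (h z - m)\<^sup>2 / (2 * c))"
        using int_q var_int by simp
      show "AE z in Q. (p z - 1) * (h z - m) \<le> (c / 2 + b / \<delta>) * q z + (h z - m)\<^sup>2 / (2 * c)"
        using h unfolding m_def[symmetric]
        by eventually_elim (unfold q_def, rule mult_le_truncated_square[OF \<delta> that])
    qed
    also have "\<dots> = (c / 2 + b / \<delta>) * (\<integral>z. q z \<partial>Q) + s\<^sup>2 / (2 * c)"
      using int_q var_int var(3) s2 by simp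
    also have "\<dots> \<le> (c / 2 + b / \<delta>) * R + s\<^sup>2 / (2 * c)"
      using b \<delta> that by (intro add_right_mono mult_left_mono q_le) auto
    finally show ?thesis .
  qed
  \<comment> \<open>The optimal choice is \<open>c = s / sqrt R\<close>; the slack \<open>e\<close> covers the case \<open>s = 0\<close>.\<close>
  have "(\<integral>z. (p z - 1) * (h z - m) \<partial>Q) \<le> sqrt R * s + b / \<delta> * R"
  proof (rule field_le_epsilon)
    fix e' :: real assume "0 < e'"
    define e where "e = e' / sqrt R"
    have e: "0 < e" "e' = sqrt R * e" using \<open>0 < e'\<close> R by (simp_all add: e_def)
    define c where "c = (s + e) / sqrt R"
    have c: "0 < c" using e s2 R by (simp add: c_def)
    have "c / 2 * (sqrt R * sqrt R) = sqrt R * (s + e) / 2"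
      using R by (simp add: c_def field_simps del: real_sqrt_mult_self)
    then have "c / 2 * R = sqrt R * (s + e) / 2"
      using R by simp
    moreover have "s\<^sup>2 / (2 * c) \<le> sqrt R * (s + e) / 2"
    proof -
      have "s\<^sup>2 \<le> (s + e)\<^sup>2" using e s2 by (intro power_mono) auto
      then have "s\<^sup>2 / (2 * c) \<le> (s + e)\<^sup>2 / (2 * c)" using c by (intro divide_right_mono) auto
      also have "\<dots> = sqrt R * (s + e) / 2" using e s2 R by (simp add: c_def power2_eq_square field_simps)
      finally show ?thesis .
    qed
    moreover have "sqrt R * (s + e) = sqrt R * s + e'" using e by (simp add: algebra_simps)
    ultimately show "(\<integral>z. (p z - 1) * (h z - m) \<partial>Q) \<le> sqrt R * s + b / \<delta> * R + e'"
      using bound[OF c] distrib_right[of "c / 2" "b / \<delta>" R] by argo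
  qed
  moreover have "(\<integral>z. (p z - 1) * (h z - m) \<partial>Q) = (\<integral>z. h z \<partial>P) - m"
  proof -
    have int: "integrable Q (\<lambda>z. p z * h z)"
    proof -
      \<comment> \<open>Integrability of \<open>p * h\<close> is read off from that of the centred
        product, already dominated by \<open>b * \<bar>p - 1\<bar>\<close>.\<close>
      have "(\<lambda>z. p z * h z) = (\<lambda>z. (p z - 1) * (h z - m) + h z + m * p z - m)"
        by (auto simp: algebra_simps)
      then show ?thesis using int_ph var(1) int_p by simp
    qed
    have "(\<lambda>z. (p z - 1) * (h z - m)) = (\<lambda>z. p z * h z - h z - m * p z + m)"
      by (auto simp: algebra_simps)
    then show ?thesis
      using int var(1) int_p p1 hP by (simp add: m_def[symmetric] Q.prob_space)
  qed
  moreover have "sqrt (R * variance_under Q h) = sqrt R * s"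
    by (simp add: s_def real_sqrt_mult)
  ultimately show ?thesis by (simp flip: m_def R_def)
qed

text \<open>The density \<open>1 + t * (h - m)\<close> has mean 1, raises the expectation of
  \<open>h\<close> by \<open>t\<close> times the variance, and costs at most
  \<open>k * t\<^sup>2\<close> times the variance in divergence. The condition
  \<open>t * b \<le> \<delta> < 1\<close> keeps it positive and within the range of the quadratic
  bound.\<close>

lemma divergence_ball_perturbation:
  assumes Q: "prob_space Q"
    and f_le: "\<And>u. \<bar>u\<bar> \<le> \<delta> \<Longrightarrow> f (1 + u) \<le> ereal (k * u\<^sup>2)"
    and "\<delta> < 1" and k: "0 \<le> k"
    and [measurable]: "h \<in> borel_measurable Q"
    and h: "AE z in Q. \<bar>h z - (\<integral>z. h z \<partial>Q)\<bar> \<le> b"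
    and t: "0 \<le> t" "t * b \<le> \<delta>" "k * t\<^sup>2 * variance_under Q h \<le> r"
  obtains P where "P \<in> divergence_ball f Q r"
    and "(\<integral>z. h z \<partial>P) = (\<integral>z. h z \<partial>Q) + t * variance_under Q h"
proof -
  interpret Q: prob_space Q by fact
  define m where "m = (\<integral>z. h z \<partial>Q)"
  \<comment> \<open>Truncation at 0 makes the density nonnegative everywhere and changes it only on
    a null set.\<close>
  define p where "p z = max 0 (1 + t * (h z - m))" for z
  define P where "P = density Q (\<lambda>z. ennreal (p z))"
  have [measurable]: "p \<in> borel_measurable Q" unfolding p_def by measurable
  have p0: "0 \<le> p z" for z by (simp add: p_def)
  note h = h[folded m_def]
  note var = Q.variance_under_eq[OF _ h[unfolded m_def], simplified, folded m_def]
  have var_int: "integrable Q (\<lambda>z. (h z - m)\<^sup>2)"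
    using var(1,2) by (simp add: power2_diff)
  have small: "AE z in Q. \<bar>t * (h z - m)\<bar> \<le> \<delta>"
    using h
  proof eventually_elim
    case (elim z)
    then have "\<bar>t * (h z - m)\<bar> \<le> t * b" using t by (simp add: abs_mult mult_left_mono)
    then show ?case using t by linarith
  qed
  have p_eq: "AE z in Q. p z = 1 + t * (h z - m)"
    using small by eventually_elim (use \<open>\<delta> < 1\<close> in \<open>simp add: p_def\<close>)
  have int_p: "integrable Q p"
    using p_eq var(1) by (subst integrable_cong_AE[where g = "\<lambda>z. 1 + t * (h z - m)"]) auto
  have "(\<integral>z. p z \<partial>Q) = (\<integral>z. 1 + t * (h z - m) \<partial>Q)"
    using p_eq by (intro integral_cong_AE) auto
  also have "\<dots> = 1" using var(1) by (simp add: Q.prob_space m_def)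
  finally have p1: "(\<integral>z. p z \<partial>Q) = 1" .
  have "prob_space P"
  proof
    have "emeasure P (space P) = (\<integral>\<^sup>+z. ennreal (p z) \<partial>Q)"
      by (simp add: P_def emeasure_density cong: nn_integral_cong)
    also have "\<dots> = 1" using p1 int_p p0 by (subst nn_integral_eq_integral) auto
    finally show "emeasure P (space P) = 1" .
  qed
  moreover have "absolutely_continuous Q P"
    unfolding P_def by (intro absolutely_continuousI_density) measurable
  moreover have "f_divergence f P Q \<le> ereal r"
  proof -
    \<comment> \<open>Almost everywhere uniqueness of the density allows the divergence, defined
      through \<open>RN_deriv\<close>, to be computed with \<open>p\<close>.\<close>
    have "AE z in Q. ennreal (p z) = RN_deriv Q P z"
      by (rule Q.RN_deriv_unique) (auto simp: P_def)
    then have "AE z in Q. e2ennreal (f (enn2real (RN_deriv Q P z))) \<le> ennreal (k * t\<^sup>2 * (h z - m)\<^sup>2)"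
      using small p_eq
    proof eventually_elim
      case (elim z)
      then have "enn2real (RN_deriv Q P z) = 1 + t * (h z - m)"
        using p0[of z] by (metis enn2real_ennreal)
      moreover have "f (1 + t * (h z - m)) \<le> ereal (k * t\<^sup>2 * (h z - m)\<^sup>2)"
        using f_le[OF elim(2)] by (simp add: power_mult_distrib mult.assoc)
      ultimately show ?case by (metis e2ennreal_ereal e2ennreal_mono)
    qed
    then have "(\<integral>\<^sup>+z. e2ennreal (f (enn2real (RN_deriv Q P z))) \<partial>Q) \<le>
        (\<integral>\<^sup>+z. ennreal (k * t\<^sup>2 * (h z - m)\<^sup>2) \<partial>Q)"
      by (rule nn_integral_mono_AE)
    also have "\<dots> = ennreal (k * t\<^sup>2 * variance_under Q h)"
      using var_int k by (subst nn_integral_eq_integral) (auto simp: var(3))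
    also have "\<dots> \<le> ennreal r" using t(3) by (rule ennreal_leI)
    finally have *: "(\<integral>\<^sup>+z. e2ennreal (f (enn2real (RN_deriv Q P z))) \<partial>Q) \<le> ennreal r" .
    have r: "0 \<le> r"
      using k by (intro order_trans[OF _ t(3)]) (simp add: var(3))
    have "f_divergence f P Q \<le> enn2ereal (\<integral>\<^sup>+z. e2ennreal (f (enn2real (RN_deriv Q P z))) \<partial>Q)"
      unfolding f_divergence_def ereal_integral_def
      by (rule ereal_diff_le_self) simp
    also have "\<dots> \<le> enn2ereal (ennreal r)" using * by (simp add: less_eq_ennreal.rep_eq)
    also have "\<dots> = ereal r" using r by (simp add: enn2ereal_ennreal)
    finally show ?thesis .
  qed
  ultimately have "P \<in> divergence_ball f Q r"
    by (simp add: divergence_ball_def P_def)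
  moreover have "(\<integral>z. h z \<partial>P) = m + t * variance_under Q h"
  proof -
    have "(\<integral>z. h z \<partial>P) = (\<integral>z. p z * h z \<partial>Q)"
      unfolding P_def using p0 by (subst integral_real_density) auto
    also have "\<dots> = (\<integral>z. h z + t * (h z - m)\<^sup>2 + m * t * (h z - m) \<partial>Q)"
    proof (rule integral_cong_AE)
      show "AE z in Q. p z * h z = h z + t * (h z - m)\<^sup>2 + m * t * (h z - m)"
        using p_eq by eventually_elim (simp only:, simp add: algebra_simps power2_eq_square)
    qed auto
    also have "\<dots> = m + t * variance_under Q h"
      using var var_int by (simp add: m_def[symmetric] Q.prob_space)
    finally show ?thesis .
  qed
  ultimately show thesis using that by (simp add: m_def)
qed

text \<open>The upper bound loses a factor \<open>1 / sqrt (1 - \<eta>)\<close> on \<open>s\<close>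
  and a tail term. The lower bound uses a slightly shrunk optimal perturbation if it is admissible;
  otherwise \<open>s\<close> itself is no larger than the tail term, and the mean \<open>m\<close>
  suffices.\<close>

lemma divergence_ball_expansion:
  assumes Q: "prob_space Q"
    and f_ge: "\<And>t. 0 \<le> t \<Longrightarrow> ereal ((1 - \<eta>) * min ((t - 1)\<^sup>2) (\<delta> * \<bar>t - 1\<bar>)) \<le> f t"
    and f_le: "\<And>u. \<bar>u\<bar> \<le> \<delta> \<Longrightarrow> f (1 + u) \<le> ereal ((1 + \<eta>) * u\<^sup>2)"
    and \<eta>: "0 < \<eta>" "\<eta> \<le> 1 / 2" and \<delta>: "0 < \<delta>" "\<delta> < 1" and r: "0 < r"
    and h[measurable]: "h \<in> borel_measurable Q"
    and h_le: "AE z in Q. \<bar>h z - (\<integral>z. h z \<partial>Q)\<bar> \<le> b"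
  defines "S \<equiv> SUP P \<in> divergence_ball f Q r. ereal (\<integral>z. h z \<partial>P)"
    and "m \<equiv> \<integral>z. h z \<partial>Q" and "s \<equiv> sqrt (r * variance_under Q h)"
  shows "\<bar>S\<bar> \<noteq> \<infinity>" and "\<bar>real_of_ereal S - m - s\<bar> \<le> 2 * \<eta> * s + 2 * b * r / \<delta>"
proof -
  interpret Q: prob_space Q by fact
  define V where "V = variance_under Q h"
  have V: "0 \<le> V" unfolding V_def Q.variance_under_eq(3)[OF h h_le] by simp
  have b: "0 \<le> b"
  proof -
    have "\<exists>z. \<bar>h z - m\<bar> \<le> b" using eventually_happens'[OF Q.ae_filter_bot h_le] by (auto simp: m_def)
    then show ?thesis by auto
  qed
  have s: "0 \<le> s" "s = sqrt r * sqrt V" using r V by (simp_all add: s_def V_def real_sqrt_mult)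
  have upper: "S \<le> ereal (m + (1 + 2 * \<eta>) * s + 2 * b * r / \<delta>)"
    unfolding S_def
  proof (rule SUP_least)
    fix P assume P: "P \<in> divergence_ball f Q r"
    have inv: "1 / (1 - \<eta>) \<le> 1 + 2 * \<eta>"
      using \<eta> mult_left_mono[of \<eta> "1/2" \<eta>] by (simp add: field_simps)
    have "sqrt (r / (1 - \<eta>) * V) \<le> sqrt ((1 + 2 * \<eta>)\<^sup>2 * (r * V))"
    proof -
      \<comment> \<open>Passing to the square gives up a little but lets the root be evaluated
        exactly.\<close>
      have "1 + 2 * \<eta> \<le> (1 + 2 * \<eta>)\<^sup>2" using \<eta> by (simp add: power2_eq_square)
      with inv have "1 / (1 - \<eta>) * (r * V) \<le> (1 + 2 * \<eta>)\<^sup>2 * (r * V)"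
        using r V by (intro mult_right_mono) auto
      then show ?thesis by simp
    qed
    also have "\<dots> = (1 + 2 * \<eta>) * s"
      using \<eta> by (simp add: real_sqrt_mult s_def V_def)
    finally have 1: "sqrt (r / (1 - \<eta>) * V) \<le> (1 + 2 * \<eta>) * s" .
    have "b / \<delta> * (r / (1 - \<eta>)) = (b * r / \<delta>) * (1 / (1 - \<eta>))" by simp
    also have "\<dots> \<le> (b * r / \<delta>) * 2"
      using inv \<eta> b r \<delta> by (intro mult_left_mono) auto
    finally have 2: "b / \<delta> * (r / (1 - \<eta>)) \<le> 2 * b * r / \<delta>" by (simp add: mult_ac)
    have "(\<integral>z. h z \<partial>P) \<le> m + sqrt (r / (1 - \<eta>) * V) + b / \<delta> * (r / (1 - \<eta>))"
      unfolding m_def V_def using \<eta> \<delta> r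
      by (intro divergence_ball_integral_le[OF Q P f_ge] h h_le) auto
    then show "ereal (\<integral>z. h z \<partial>P) \<le> ereal (m + (1 + 2 * \<eta>) * s + 2 * b * r / \<delta>)"
      using 1 2 by simp
  qed
  have lower: "ereal (m + t * V) \<le> S" if t: "0 \<le> t" "t * b \<le> \<delta>" "(1 + \<eta>) * t\<^sup>2 * V \<le> r" for t
  proof -
    obtain P where "P \<in> divergence_ball f Q r" "(\<integral>z. h z \<partial>P) = m + t * V"
      using divergence_ball_perturbation[OF Q f_le \<delta>(2) _ h h_le t(1,2) t(3)[unfolded V_def]] \<eta>
      unfolding m_def V_def by force
    then show ?thesis unfolding S_def by (metis SUP_upper)
  qed
  \<comment> \<open>The choice \<open>t = 0\<close> gives a member of the ball with mean
    \<open>m\<close>, which excludes the value \<open>-\<infinity>\<close>; the upper bound excludes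
    \<open>\<infinity>\<close>.\<close>
  have "ereal m \<le> S" using lower[of 0] r \<delta> by simp
  then show fin: "\<bar>S\<bar> \<noteq> \<infinity>" using upper by auto
  have bd: "0 \<le> 2 * b * r / \<delta>" using b r \<delta> by simp
  have \<eta>s: "(1 - 2 * \<eta>) * s \<le> (1 - \<eta>) * s" "(1 - 2 * \<eta>) * s \<le> s"
    using \<eta> s by (auto intro: mult_right_mono mult_left_le_one_le)
  have "m + (1 - 2 * \<eta>) * s - 2 * b * r / \<delta> \<le> real_of_ereal S"
  \<comment> \<open>For \<open>0 < V\<close> the second condition says that
    \<open>t = sqrt (r / V)\<close>, which exhausts the radius to leading order, satisfies
    \<open>t * b \<le> \<delta>\<close>.\<close>
  proof (cases "0 < V \<and> sqrt r * b \<le> \<delta> * sqrt V")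
    case True
    \<comment> \<open>The factor \<open>1 - \<eta>\<close> compensates the constant
      \<open>1 + \<eta>\<close> in the divergence bound, as
      \<open>(1 + \<eta>) * (1 - \<eta>)\<^sup>2 \<le> 1\<close>; the gain is still
      \<open>(1 - \<eta>) * s\<close>.\<close>
    define t where "t = (1 - \<eta>) * sqrt r / sqrt V"
    have t: "0 \<le> t" using \<eta> r V by (simp add: t_def)
    have "(1 - \<eta>) * (sqrt r * b) \<le> sqrt r * b"
      using \<eta> r b by (intro mult_left_le_one_le) auto
    then have "(1 - \<eta>) * (sqrt r * b) \<le> \<delta> * sqrt V" using True by linarith
    then have "t * b \<le> \<delta>" using True by (simp add: t_def field_simps)
    moreover have "(1 + \<eta>) * t\<^sup>2 * V \<le> r"
    proof -
      have "(1 + \<eta>) * t\<^sup>2 * V = (1 + \<eta>) * (1 - \<eta>)\<^sup>2 * r"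
        using True r by (simp add: t_def power_mult_distrib power_divide)
      also have "(1 + \<eta>) * (1 - \<eta>)\<^sup>2 = (1 - \<eta>\<^sup>2) * (1 - \<eta>)" by (simp add: power2_eq_square algebra_simps)
      also have "\<dots> * r \<le> 1 * 1 * r"
        using \<eta> r by (intro mult_right_mono mult_mono) (auto simp: power_le_one)
      finally show ?thesis by simp
    qed
    ultimately have "ereal (m + t * V) \<le> S" using lower[OF t] by simp
    then have "m + t * V \<le> real_of_ereal S" using fin by (simp add: ereal_real' flip: ereal_less_eq(3))
    moreover have "t * V = (1 - \<eta>) * s"
    proof -
      have "t * (sqrt V * sqrt V) = (1 - \<eta>) * s"
        using True by (simp add: t_def s(2) del: real_sqrt_mult_self)
      then show ?thesis using V by simp
    qed
    ultimately show ?thesis using bd \<eta>s by argo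
  next
    case False
    have "s \<le> 2 * b * r / \<delta>"
    proof (cases "V = 0")
      case True
      then show ?thesis using bd s by simp
    next
      case False
      with \<open>\<not> (0 < V \<and> _)\<close> V have "\<delta> * sqrt V \<le> sqrt r * b" by simp
      then have "sqrt r * (\<delta> * sqrt V) \<le> sqrt r * (sqrt r * b)" using r by (intro mult_left_mono) auto
      then have "\<delta> * s \<le> (sqrt r * sqrt r) * b" by (simp only: s mult_ac)
      then have "s \<le> b * r / \<delta>" using \<delta> r by (simp add: field_simps)
      moreover have "0 \<le> b * r / \<delta>" using b r \<delta> by simp
      moreover have "2 * b * r / \<delta> = 2 * (b * r / \<delta>)" by simp
      ultimately show ?thesis by linarith
    qed
    moreover have "m \<le> real_of_ereal S" using \<open>ereal m \<le> S\<close> fin by (simp add: ereal_real' flip: ereal_less_eq(3))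
    ultimately show ?thesis using bd \<eta>s by argo
  qed
  moreover have "real_of_ereal S \<le> m + (1 + 2 * \<eta>) * s + 2 * b * r / \<delta>"
    using upper fin by (simp add: ereal_real' flip: ereal_less_eq(3))
  ultimately show "\<bar>real_of_ereal S - m - s\<bar> \<le> 2 * \<eta> * s + 2 * b * r / \<delta>"
    by (simp add: abs_le_iff algebra_simps)
qed

text \<open>The quantifier order is the point: \<open>\<delta>\<close> depends on \<open>f\<close>
  and \<open>\<eta>\<close> alone, so the expansion is uniform over the empirical measures and over
  the decision \<open>x\<close>.\<close>

lemma smooth_divergence_fun_expansion:
  fixes f :: "real \<Rightarrow> ereal"
  assumes f: "smooth_divergence_fun f" and \<eta>: "0 < \<eta>" "\<eta> \<le> 1 / 2"
  obtains \<delta> where "0 < \<delta>"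
    "\<And>(Q :: 'a measure) r h b. prob_space Q \<Longrightarrow> 0 < r \<Longrightarrow> h \<in> borel_measurable Q \<Longrightarrow>
      AE z in Q. \<bar>h z - (\<integral>z. h z \<partial>Q)\<bar> \<le> b \<Longrightarrow>
      \<bar>SUP P \<in> divergence_ball f Q r. ereal (\<integral>z. h z \<partial>P)\<bar> \<noteq> \<infinity> \<and>
      \<bar>real_of_ereal (SUP P \<in> divergence_ball f Q r. ereal (\<integral>z. h z \<partial>P)) -
         (\<integral>z. h z \<partial>Q) - sqrt (r * variance_under Q h)\<bar>
        \<le> 2 * \<eta> * sqrt (r * variance_under Q h) + 2 * b * r / \<delta>"
proof -
  obtain \<delta> where \<delta>: "0 < \<delta>" "\<delta> < 1" and near:
    "\<And>u. \<bar>u\<bar> \<le> \<delta> \<Longrightarrow> ereal ((1 - \<eta>) * u\<^sup>2) \<le> f (1 + u) \<and> f (1 + u) \<le> ereal ((1 + \<eta>) * u\<^sup>2)"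
    using smooth_divergence_fun_near_one[OF f \<eta>(1)] by metis
  have "ereal ((1 - \<eta>) * min ((t - 1)\<^sup>2) (\<delta> * \<bar>t - 1\<bar>)) \<le> f t" if "0 \<le> t" for t
    using \<eta> near that by (intro smooth_divergence_fun_growth[OF f \<delta>]) auto
  note expansion = divergence_ball_expansion[OF _ this conjunct2[OF near] \<eta> \<delta>]
  show thesis
    by (rule that[OF \<delta>(1)], intro conjI expansion)
qed

section \<open>Empirical measures and tail bounds\<close>

context
  fixes S :: "'a measure" and n :: nat and z :: "nat \<Rightarrow> 'a"
  assumes n: "1 \<le> n" and z: "\<And>i. i < n \<Longrightarrow> z i \<in> space S"
begin

lemma measurable_sample: "z \<in> measurable (uniform_count_measure {..<n}) S"
  using z by (auto simp: measurable_def space_uniform_count_measure sets_uniform_count_measure)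

lemma prob_space_empirical_measure: "prob_space (empirical_measure S n z)"
  unfolding empirical_measure_def using n measurable_sample
  by (intro prob_space.prob_space_distr prob_space_uniform_count_measure) (auto simp: lessThan_empty_iff)

lemma measurable_empirical_measure: "g \<in> measurable (empirical_measure S n z) T \<longleftrightarrow> g \<in> measurable S T"
  by (simp add: empirical_measure_def)

lemma integral_empirical_measure:
  fixes g :: "'a \<Rightarrow> real"
  assumes "g \<in> borel_measurable S"
  shows "(\<integral>w. g w \<partial>empirical_measure S n z) = (\<Sum>i<n. g (z i)) / n"
  unfolding empirical_measure_def
  using assms by (simp add: integral_distr[OF measurable_sample] integral_uniform_count_measure)

lemma AE_empirical_measure:
  assumes "{w \<in> space S. P w} \<in> sets S" and "\<And>i. i < n \<Longrightarrow> P (z i)"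
  shows "AE w in empirical_measure S n z. P w"
  unfolding empirical_measure_def
  using assms by (subst AE_distr_iff[OF measurable_sample]) (auto simp: space_uniform_count_measure intro!: AE_I2)

text \<open>The sample values, and hence their mean, lie in \<open>[-b, b]\<close>; this is the
  source of the factor 2.\<close>

lemma empirical_deviation_le:
  fixes h :: "'a \<Rightarrow> real"
  assumes [measurable]: "h \<in> borel_measurable S" and b: "\<And>i. i < n \<Longrightarrow> \<bar>h (z i)\<bar> \<le> b"
  shows "AE w in empirical_measure S n z. \<bar>h w - (\<integral>w. h w \<partial>empirical_measure S n z)\<bar> \<le> 2 * b"
proof (rule AE_empirical_measure)
  let ?m = "\<integral>w. h w \<partial>empirical_measure S n z"
  have "\<bar>\<Sum>i<n. h (z i)\<bar> \<le> (\<Sum>i<n. b)"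
    using b by (intro order_trans[OF sum_abs] sum_mono) auto
  then have m: "\<bar>?m\<bar> \<le> b"
    using n by (simp add: integral_empirical_measure field_simps)
  show "\<bar>h (z i) - ?m\<bar> \<le> 2 * b" if "i < n" for i
    using b[OF that] m by linarith
qed measurable

text \<open>Dropping the squared mean leaves the second moment. The envelope \<open>H\<close> gives
  one bound for all functions below it.\<close>

lemma variance_under_empirical_le:
  assumes [measurable]: "h \<in> borel_measurable S" and b: "\<And>i. i < n \<Longrightarrow> \<bar>h (z i)\<bar> \<le> H (z i)"
  shows "variance_under (empirical_measure S n z) h \<le> (\<Sum>i<n. (H (z i))\<^sup>2) / n"
proof -
  have "variance_under (empirical_measure S n z) h \<le> (\<Sum>i<n. (h (z i))\<^sup>2) / n"
    by (simp add: variance_under_def integral_empirical_measure)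
  also have "\<dots> \<le> (\<Sum>i<n. (H (z i))\<^sup>2) / n"
    using b by (intro divide_right_mono sum_mono) (force simp: abs_le_square_iff[symmetric])+
  finally show ?thesis .
qed

end

text \<open>On the event, \<open>c * n\<close> is below \<open>U\<close>, so \<open>c * n\<close>
  times its probability is at most the integral of \<open>U\<close> over it, which tends to 0 by
  dominated convergence. Markov's inequality alone would only give boundedness.\<close>

lemma tendsto_mult_tail_probability:
  fixes U :: "'a \<Rightarrow> real"
  assumes M: "prob_space M" and int: "integrable M U" and U0: "\<And>z. 0 \<le> U z" and c: "0 < c"
  shows "(\<lambda>n. real n * measure M {z \<in> space M. c * real n < U z}) \<longlonglongrightarrow> 0"
proof -
  interpret prob_space M by fact
  have [measurable]: "U \<in> borel_measurable M" using int by auto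
  define A where "A n = {z \<in> space M. c * real n < U z}" for n
  have [measurable]: "A n \<in> sets M" for n by (simp add: A_def)
  have int': "integrable M (\<lambda>z. U z * indicator (A n) z)" for n
    using integrable_mult_indicator[OF _ int, of "A n"] by (simp add: mult.commute)
  have "(\<lambda>n. \<integral>z. U z * indicator (A n) z \<partial>M) \<longlonglongrightarrow> (\<integral>z. 0 \<partial>M)"
  proof (rule integral_dominated_convergence[where w = U])
    show "AE z in M. (\<lambda>n. U z * indicator (A n) z) \<longlonglongrightarrow> 0"
    proof (rule AE_I2, rule tendsto_eventually)
      fix z
      obtain k :: nat where "U z / c \<le> k" using real_arch_simple by blast
      have "U z \<le> c * real n" if "k \<le> n" for n
      proof -
        have "U z / c \<le> real n" using \<open>U z / c \<le> k\<close> that by (meson of_nat_mono order_trans)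
        then show ?thesis using c by (simp add: field_simps)
      qed
      then show "\<forall>\<^sub>F n in sequentially. U z * indicator (A n) z = 0"
        by (intro eventually_sequentiallyI[of k]) (force simp: A_def indicator_def)
    qed
  qed (use int U0 in \<open>auto simp: indicator_def\<close>)
  then have "(\<lambda>n. (\<integral>z. U z * indicator (A n) z \<partial>M) / c) \<longlonglongrightarrow> 0"
    using tendsto_divide_zero by fastforce
  moreover have "real n * measure M (A n) \<le> (\<integral>z. U z * indicator (A n) z \<partial>M) / c" for n
  proof -
    have "c * real n * measure M (A n) = (\<integral>z. c * real n * indicator (A n) z \<partial>M)" by simp
    also have "\<dots> \<le> (\<integral>z. U z * indicator (A n) z \<partial>M)"
      by (intro integral_mono int' integrable_mult_right integrable_real_indicator)
        (auto simp: A_def indicator_def less_top[symmetric])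
    finally show ?thesis using c by (simp add: field_simps)
  qed
  then have "norm (real n * measure M (A n)) \<le> (\<integral>z. U z * indicator (A n) z \<partial>M) / c" for n
    by simp
  ultimately show ?thesis
    unfolding A_def[symmetric] by (rule Lim_null_comparison[OF always_eventually[OF allI], rotated])
qed

text \<open>The first bound is Markov's inequality for the mean of squares, whose expectation is the
  same for all \<open>n\<close>. The second is a union bound: \<open>n\<close> times the tail
  probability of \<open>H\<^sup>2\<close> beyond a multiple of \<open>n\<close> vanishes in the
  limit.\<close>

lemma
  fixes H :: "'b \<Rightarrow> real" and \<xi> :: "nat \<Rightarrow> 'w \<Rightarrow> 'b"
  assumes \<Omega>: "prob_space \<Omega>" and P: "prob_space P"
    and \<xi>[measurable]: "\<And>i. \<xi> i \<in> measurable \<Omega> P" and distr: "\<And>i. distr \<Omega> P (\<xi> i) = P"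
    and H[measurable]: "H \<in> borel_measurable P" and int: "integrable P (\<lambda>z. (H z)\<^sup>2)"
  shows prob_mean_square_ge: "0 < a \<Longrightarrow> 1 \<le> n \<Longrightarrow>
      measure \<Omega> {\<omega> \<in> space \<Omega>. a \<le> (\<Sum>i<n. (H (\<xi> i \<omega>))\<^sup>2) / real n} \<le> (\<integral>z. (H z)\<^sup>2 \<partial>P) / a"
    and tendsto_prob_max_gt: "0 < \<kappa> \<Longrightarrow>
      (\<lambda>n. measure \<Omega> {\<omega> \<in> space \<Omega>. \<exists>i<n. \<kappa> * sqrt (real n) < \<bar>H (\<xi> i \<omega>)\<bar>}) \<longlonglongrightarrow> 0"
proof -
  interpret \<Omega>: prob_space \<Omega> by fact
  have int_i: "integrable \<Omega> (\<lambda>\<omega>. (H (\<xi> i \<omega>))\<^sup>2)"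
    and E_i: "(\<integral>\<omega>. (H (\<xi> i \<omega>))\<^sup>2 \<partial>\<Omega>) = (\<integral>z. (H z)\<^sup>2 \<partial>P)" for i
    using int integrable_distr[OF \<xi>[of i], of "\<lambda>z. (H z)\<^sup>2"] integral_distr[OF \<xi>[of i], of "\<lambda>z. (H z)\<^sup>2"]
    by (simp_all add: distr)
  show "measure \<Omega> {\<omega> \<in> space \<Omega>. a \<le> (\<Sum>i<n. (H (\<xi> i \<omega>))\<^sup>2) / real n} \<le> (\<integral>z. (H z)\<^sup>2 \<partial>P) / a"
    if "0 < a" "1 \<le> n"
  proof -
    have "measure \<Omega> {\<omega> \<in> space \<Omega>. a \<le> (\<Sum>i<n. (H (\<xi> i \<omega>))\<^sup>2) / real n} \<le>
        (\<integral>\<omega>. (\<Sum>i<n. (H (\<xi> i \<omega>))\<^sup>2) / real n \<partial>\<Omega>) / a"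
      using int_i that by (intro integral_Markov_inequality_measure[where A = "{}"]) (auto simp: sum_nonneg)
    also have "(\<integral>\<omega>. (\<Sum>i<n. (H (\<xi> i \<omega>))\<^sup>2) / real n \<partial>\<Omega>) = (\<integral>z. (H z)\<^sup>2 \<partial>P)"
      using int_i that by (simp add: E_i)
    finally show ?thesis .
  qed
  show "(\<lambda>n. measure \<Omega> {\<omega> \<in> space \<Omega>. \<exists>i<n. \<kappa> * sqrt (real n) < \<bar>H (\<xi> i \<omega>)\<bar>}) \<longlonglongrightarrow> 0"
    if \<kappa>: "0 < \<kappa>"
  proof (rule tendsto_sandwich[OF _ _ tendsto_const])
    show "(\<lambda>n. real n * measure P {z \<in> space P. \<kappa>\<^sup>2 * real n < (H z)\<^sup>2}) \<longlonglongrightarrow> 0"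
      using \<kappa> by (intro tendsto_mult_tail_probability[OF P int]) auto
    have "measure \<Omega> {\<omega> \<in> space \<Omega>. \<exists>i<n. \<kappa> * sqrt (real n) < \<bar>H (\<xi> i \<omega>)\<bar>} \<le>
        real n * measure P {z \<in> space P. \<kappa>\<^sup>2 * real n < (H z)\<^sup>2}" for n
    proof -
      let ?B = "{z \<in> space P. \<kappa>\<^sup>2 * real n < (H z)\<^sup>2}"
      have sq: "\<kappa> * sqrt (real n) < \<bar>y\<bar> \<longleftrightarrow> \<kappa>\<^sup>2 * real n < y\<^sup>2" for y :: real
        using \<kappa> real_sqrt_less_iff[of "\<kappa>\<^sup>2 * real n" "y\<^sup>2"] by (simp add: real_sqrt_mult)
      have "{\<omega> \<in> space \<Omega>. \<exists>i<n. \<kappa> * sqrt (real n) < \<bar>H (\<xi> i \<omega>)\<bar>} = (\<Union>i<n. \<xi> i -` ?B \<inter> space \<Omega>)"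
        using measurable_space[OF \<xi>] by (auto simp: sq)
      also have "measure \<Omega> \<dots> \<le> (\<Sum>i<n. measure \<Omega> (\<xi> i -` ?B \<inter> space \<Omega>))"
        by (intro \<Omega>.finite_measure_subadditive_finite) auto
      also have "\<dots> = (\<Sum>i<n. measure P ?B)"
        by (intro sum.cong refl) (subst (2) distr[symmetric], subst measure_distr, auto)
      finally show ?thesis by simp
    qed
    then show "\<forall>\<^sub>F n in sequentially. measure \<Omega> {\<omega> \<in> space \<Omega>. \<exists>i<n. \<kappa> * sqrt (real n) < \<bar>H (\<xi> i \<omega>)\<bar>} \<le>
        real n * measure P {z \<in> space P. \<kappa>\<^sup>2 * real n < (H z)\<^sup>2}" by simp
  qed simp
qed

text \<open>Expansion in the basis, the triangle inequality and homogeneity give \<open>K\<close> as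
  the sum of the \<open>N\<close>-norms of the basis vectors. It serves to bound \<open>N\<close> on
  a compact set.\<close>

lemma is_norm_bounded:
  fixes N :: "'a::euclidean_space \<Rightarrow> real"
  assumes N: "is_norm N"
  obtains K where "0 \<le> K" "\<And>x. N x \<le> K * norm x"
proof
  note N' = N[unfolded is_norm_def]
  show "0 \<le> (\<Sum>b\<in>Basis. N b)" using N' by (simp add: sum_nonneg)
  fix x :: 'a
  have sum_le: "N (\<Sum>b\<in>A. g b) \<le> (\<Sum>b\<in>A. N (g b))" if "finite A" for A :: "'a set" and g
    using that
  proof induction
    case empty
    then show ?case using N' by (simp del: order_refl) (metis order_refl)
  next
    case (insert b A)
    have "N (g b + sum g A) \<le> N (g b) + N (sum g A)" using N' by blast
    with insert show ?case by simp
  qed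
  have "N x = N (\<Sum>b\<in>Basis. (x \<bullet> b) *\<^sub>R b)" by (simp add: euclidean_representation)
  also have "\<dots> \<le> (\<Sum>b\<in>Basis. \<bar>x \<bullet> b\<bar> * N b)"
    using sum_le[of Basis "\<lambda>b. (x \<bullet> b) *\<^sub>R b"] N' by simp
  also have "\<dots> \<le> (\<Sum>b\<in>Basis. norm x * N b)"
    using N' by (intro sum_mono mult_right_mono) (auto simp: Basis_le_norm)
  finally show "N x \<le> (\<Sum>b\<in>Basis. N b) * norm x" by (simp add: sum_distrib_left mult.commute)
qed

section \<open>Uniform expansion\<close>

theorem theorem1:
  fixes P\<^sub>0 :: "'b::{metric_space, second_countable_topology} measure"
    and \<Omega> :: "'w measure"
    and \<xi> :: "nat \<Rightarrow> 'w \<Rightarrow> 'b"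
    and X :: "(real ^ 'd) set"
    and l :: "real ^ 'd \<Rightarrow> 'b \<Rightarrow> real"
    and M :: "'b \<Rightarrow> real"
    and N :: "real ^ 'd \<Rightarrow> real"
    and f :: "real \<Rightarrow> ereal"
    and \<rho> :: real
    and x\<^sub>0 :: "real ^ 'd"
  assumes "prob_space P\<^sub>0"
    and "X \<noteq> {}" and "compact X"
    and "\<And>x. x \<in> X \<Longrightarrow> l x \<in> borel_measurable P\<^sub>0"
    and "M \<in> borel_measurable P\<^sub>0"
    and "\<And>z. z \<in> space P\<^sub>0 \<Longrightarrow> 0 \<le> M z"
    and "is_norm N"
    and "\<And>z x y. z \<in> space P\<^sub>0 \<Longrightarrow> x \<in> X \<Longrightarrow> y \<in> X \<Longrightarrow> \<bar>l x z - l y z\<bar> \<le> M z * N (x - y)"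
    and "integrable P\<^sub>0 (\<lambda>z. (M z)\<^sup>2)"
    and "x\<^sub>0 \<in> X" and "integrable P\<^sub>0 (\<lambda>z. \<bar>l x\<^sub>0 z\<bar>\<^sup>2)"
    and "smooth_divergence_fun f"
    and "\<rho> > 0"
    and "prob_space \<Omega>"
    and "prob_space.indep_vars \<Omega> (\<lambda>_. P\<^sub>0) \<xi> UNIV"
    and "\<And>i. distr \<Omega> P\<^sub>0 (\<xi> i) = P\<^sub>0"
  shows "\<exists>\<epsilon> :: nat \<Rightarrow> real ^ 'd \<Rightarrow> 'w \<Rightarrow> real.
    (\<forall>n\<ge>1. \<forall>\<omega>\<in>space \<Omega>. \<forall>x\<in>X.
      (let Q = empirical_measure P\<^sub>0 n (\<lambda>i. \<xi> i \<omega>) in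
        (SUP P \<in> divergence_ball f Q (\<rho> / real n). ereal (\<integral>z. l x z \<partial>P)) =
        ereal ((\<integral>z. l x z \<partial>Q) + sqrt (\<rho> / real n * variance_under Q (l x)) + \<epsilon> n x \<omega>))) \<and>
    tendsto_zero_in_outer_prob \<Omega>
      (\<lambda>n \<omega>. SUP x\<in>X. ereal (sqrt (real n) * \<bar>\<epsilon> n x \<omega>\<bar>))"
proof -
  interpret \<Omega>: prob_space \<Omega> by fact
  have \<xi>[measurable]: "\<xi> i \<in> measurable \<Omega> P\<^sub>0" for i
    using \<open>\<Omega>.indep_vars (\<lambda>_. P\<^sub>0) \<xi> UNIV\<close> by (simp add: \<Omega>.indep_vars_def)
  note [measurable] = assms(4)[OF assms(10)] assms(5)
  obtain D where D: "0 \<le> D" "\<And>x. x \<in> X \<Longrightarrow> N (x - x\<^sub>0) \<le> D"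
  proof -
    obtain K where K: "0 \<le> K" "\<And>x. N x \<le> K * norm x"
      using is_norm_bounded[OF \<open>is_norm N\<close>] by blast
    obtain a where a: "\<And>x. x \<in> X \<Longrightarrow> norm x \<le> a"
      using compact_imp_bounded[OF \<open>compact X\<close>] by (auto simp: bounded_iff)
    have "N (x - x\<^sub>0) \<le> K * (2 * a)" if "x \<in> X" for x
    proof -
      have "norm (x - x\<^sub>0) \<le> 2 * a"
        using norm_triangle_ineq4[of x x\<^sub>0] a[OF that] a[OF \<open>x\<^sub>0 \<in> X\<close>] by linarith
      then show ?thesis using K by (meson mult_left_mono order_trans)
    qed
    moreover have "0 \<le> K * (2 * a)"
      using K(1) a[OF \<open>x\<^sub>0 \<in> X\<close>] norm_ge_zero[of x\<^sub>0] by (intro mult_nonneg_nonneg) linarith+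
    ultimately show thesis using that by blast
  qed
  \<comment> \<open>The Lipschitz condition between \<open>x\<close> and \<open>x\<^sub>0\<close>
    makes this an envelope of all \<open>l x\<close>.\<close>
  define H where "H z = \<bar>l x\<^sub>0 z\<bar> + M z * D" for z
  have H[measurable]: "H \<in> borel_measurable P\<^sub>0" unfolding H_def by measurable
  have l_le: "\<bar>l x z\<bar> \<le> H z" if "x \<in> X" "z \<in> space P\<^sub>0" for x z
  proof -
    have "\<bar>l x z - l x\<^sub>0 z\<bar> \<le> M z * D"
      using assms(8)[OF that(2,1) \<open>x\<^sub>0 \<in> X\<close>] mult_left_mono[OF D(2)[OF that(1)] assms(6)[OF that(2)]]
      by linarith
    then show ?thesis by (simp add: H_def)
  qed
  have int_H: "integrable P\<^sub>0 (\<lambda>z. (H z)\<^sup>2)"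
  proof (rule Bochner_Integration.integrable_bound)
    show "integrable P\<^sub>0 (\<lambda>z. 2 * \<bar>l x\<^sub>0 z\<bar>\<^sup>2 + 2 * D\<^sup>2 * (M z)\<^sup>2)"
      using assms(9,11) by simp
    have "(a + m * D)\<^sup>2 \<le> 2 * a\<^sup>2 + 2 * D\<^sup>2 * m\<^sup>2" for a m :: real
      using zero_le_power2[of "a - m * D"] by (simp add: power2_eq_square algebra_simps)
    then have "norm ((H z)\<^sup>2) \<le> norm (2 * \<bar>l x\<^sub>0 z\<bar>\<^sup>2 + 2 * D\<^sup>2 * (M z)\<^sup>2)" for z
      unfolding H_def real_norm_def abs_power2 by (rule order_trans) (rule abs_ge_self)
    then show "AE z in P\<^sub>0. norm ((H z)\<^sup>2) \<le> norm (2 * \<bar>l x\<^sub>0 z\<bar>\<^sup>2 + 2 * D\<^sup>2 * (M z)\<^sup>2)"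
      by simp
  qed measurable
  define Q where "Q n \<omega> = empirical_measure P\<^sub>0 n (\<lambda>i. \<xi> i \<omega>)" for n \<omega>
  define S where "S n x \<omega> = (SUP P \<in> divergence_ball f (Q n \<omega>) (\<rho> / real n). ereal (\<integral>z. l x z \<partial>P))"
    for n x \<omega>
  \<comment> \<open>As the remainder is defined by subtraction, the claimed identity only needs
    finiteness of \<open>S\<close>; the content lies in the bound on
    \<open>\<epsilon>\<close>.\<close>
  define \<epsilon> where "\<epsilon> n x \<omega> = real_of_ereal (S n x \<omega>) - (\<integral>z. l x z \<partial>Q n \<omega>) -
    sqrt (\<rho> / real n * variance_under (Q n \<omega>) (l x))" for n x \<omega>
  have expansion: "\<exists>\<delta>>0. \<forall>n\<ge>1. \<forall>\<omega>\<in>space \<Omega>. \<forall>x\<in>X. \<forall>b. (\<forall>i<n. \<bar>l x (\<xi> i \<omega>)\<bar> \<le> b) \<longrightarrow>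
      \<bar>S n x \<omega>\<bar> \<noteq> \<infinity> \<and>
      \<bar>\<epsilon> n x \<omega>\<bar> \<le> 2 * \<eta> * sqrt (\<rho> / n * variance_under (Q n \<omega>) (l x)) + 2 * (2 * b) * (\<rho> / n) / \<delta>"
    if \<eta>: "0 < \<eta>" "\<eta> \<le> 1 / 2" for \<eta>
  proof (rule smooth_divergence_fun_expansion[where 'a = 'b, OF \<open>smooth_divergence_fun f\<close> \<eta>])
    fix \<delta> :: real assume \<delta>: "0 < \<delta>"
    assume exp: "\<And>(Q :: 'b measure) r h b. prob_space Q \<Longrightarrow> 0 < r \<Longrightarrow> h \<in> borel_measurable Q \<Longrightarrow>
      AE z in Q. \<bar>h z - (\<integral>z. h z \<partial>Q)\<bar> \<le> b \<Longrightarrow>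
      \<bar>SUP P \<in> divergence_ball f Q r. ereal (\<integral>z. h z \<partial>P)\<bar> \<noteq> \<infinity> \<and>
      \<bar>real_of_ereal (SUP P \<in> divergence_ball f Q r. ereal (\<integral>z. h z \<partial>P)) -
         (\<integral>z. h z \<partial>Q) - sqrt (r * variance_under Q h)\<bar>
        \<le> 2 * \<eta> * sqrt (r * variance_under Q h) + 2 * b * r / \<delta>"
    show ?thesis
    proof (intro exI[of _ \<delta>] conjI[OF \<delta>] allI ballI impI)
      fix n :: nat and \<omega> x b assume n: "1 \<le> n" and \<omega>: "\<omega> \<in> space \<Omega>" and x: "x \<in> X"
        and b: "\<forall>i<n. \<bar>l x (\<xi> i \<omega>)\<bar> \<le> b"
      have \<xi>_in: "\<xi> i \<omega> \<in> space P\<^sub>0" for i using measurable_space[OF \<xi> \<omega>] .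
      show "\<bar>S n x \<omega>\<bar> \<noteq> \<infinity> \<and>
        \<bar>\<epsilon> n x \<omega>\<bar> \<le> 2 * \<eta> * sqrt (\<rho> / n * variance_under (Q n \<omega>) (l x)) + 2 * (2 * b) * (\<rho> / n) / \<delta>"
        unfolding S_def \<epsilon>_def Q_def
      proof (intro exp)
        show "0 < \<rho> / n" using n \<open>\<rho> > 0\<close> by simp
      qed (use n \<xi>_in b assms(4)[OF x] in \<open>auto intro!: prob_space_empirical_measure
        empirical_deviation_le simp: measurable_empirical_measure\<close>)
    qed
  qed
  have "\<bar>S n x \<omega>\<bar> \<noteq> \<infinity>" if "1 \<le> n" "\<omega> \<in> space \<Omega>" "x \<in> X" for n \<omega> x
  proof -
    \<comment> \<open>For finiteness any bound on the finitely many sample values will do, and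
      \<open>\<eta> = 1/2\<close> is an arbitrary choice.\<close>
    have "\<bar>l x (\<xi> i \<omega>)\<bar> \<le> (\<Sum>i<n. \<bar>l x (\<xi> i \<omega>)\<bar>)" if "i < n" for i
      using that by (intro member_le_sum) auto
    moreover note expansion[OF half_gt_zero[OF zero_less_one] order_refl]
    ultimately show ?thesis using that by meson
  qed
  then have eq: "S n x \<omega> = ereal ((\<integral>z. l x z \<partial>Q n \<omega>) +
      sqrt (\<rho> / real n * variance_under (Q n \<omega>) (l x)) + \<epsilon> n x \<omega>)"
    if "1 \<le> n" "\<omega> \<in> space \<Omega>" "x \<in> X" for n \<omega> x
    using that by (simp add: \<epsilon>_def ereal_real')

  \<comment> \<open>The two bad events: a large empirical second moment of the envelope, and a
    sample value of order \<open>sqrt n\<close>.\<close>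
  define A where "A a n = {\<omega> \<in> space \<Omega>. a \<le> (\<Sum>i<n. (H (\<xi> i \<omega>))\<^sup>2) / real n}" for a n
  define B where "B \<kappa> n = {\<omega> \<in> space \<Omega>. \<exists>i<n. \<kappa> * sqrt (real n) < \<bar>H (\<xi> i \<omega>)\<bar>}" for \<kappa> n
  have AB[measurable]: "A a n \<in> sets \<Omega>" "B \<kappa> n \<in> sets \<Omega>" for a \<kappa> n
    unfolding A_def B_def by measurable
  note tails = \<open>prob_space \<Omega>\<close> \<open>prob_space P\<^sub>0\<close> \<xi> assms(16) H int_H
  \<comment> \<open>A deterministic inclusion into measurable events lets the possibly nonmeasurable
    supremum be handled by outer measure. The threshold \<open>\<kappa>\<close> may depend on
    \<open>\<tau>\<close> and \<open>a\<close>, but not on \<open>n\<close>.\<close>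
  have bad: "\<exists>\<kappa>>0. \<forall>n\<ge>1. {\<omega> \<in> space \<Omega>. ereal \<tau> < (SUP x\<in>X. ereal (sqrt (real n) * \<bar>\<epsilon> n x \<omega>\<bar>))} \<subseteq> A a n \<union> B \<kappa> n"
    if "0 < \<tau>" "0 < a" for \<tau> a
  proof -
    \<comment> \<open>Chosen so that the variance part of the error, at most
      \<open>2 * \<eta> * sqrt (\<rho> * a)\<close> after scaling, takes up at most
      \<open>\<tau> / 2\<close>.\<close>
    define \<eta> where "\<eta> = min (1 / 2) (\<tau> / (4 * sqrt (\<rho> * a)))"
    have \<eta>: "0 < \<eta>" "\<eta> \<le> 1 / 2" using that \<open>\<rho> > 0\<close> by (auto simp: \<eta>_def)
    have "\<eta> \<le> \<tau> / (4 * sqrt (\<rho> * a))" by (simp add: \<eta>_def)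
    then have \<eta>_le: "2 * \<eta> * sqrt (\<rho> * a) \<le> \<tau> / 2"
      using that \<open>\<rho> > 0\<close> by (simp add: field_simps)
    obtain \<delta> where "0 < \<delta>" and \<delta>: "\<And>n \<omega> x b. 1 \<le> n \<Longrightarrow> \<omega> \<in> space \<Omega> \<Longrightarrow> x \<in> X \<Longrightarrow>
        (\<And>i. i < n \<Longrightarrow> \<bar>l x (\<xi> i \<omega>)\<bar> \<le> b) \<Longrightarrow>
        \<bar>\<epsilon> n x \<omega>\<bar> \<le> 2 * \<eta> * sqrt (\<rho> / n * variance_under (Q n \<omega>) (l x)) + 2 * (2 * b) * (\<rho> / n) / \<delta>"
      using expansion[OF \<eta>] by metis
    \<comment> \<open>Chosen so that the scaled tail term
      \<open>4 * \<kappa> * \<rho> / \<delta>\<close> equals the other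
      \<open>\<tau> / 2\<close>.\<close>
    define \<kappa> where "\<kappa> = \<tau> * \<delta> / (8 * \<rho>)"
    have "0 < \<kappa>" using that \<open>\<rho> > 0\<close> \<open>0 < \<delta>\<close> by (simp add: \<kappa>_def)
    have "(SUP x\<in>X. ereal (sqrt (real n) * \<bar>\<epsilon> n x \<omega>\<bar>)) \<le> ereal \<tau>"
      if n: "1 \<le> n" and \<omega>: "\<omega> \<in> space \<Omega>" and good: "\<omega> \<notin> A a n" "\<omega> \<notin> B \<kappa> n" for n \<omega>
    proof (rule SUP_least)
      fix x assume x: "x \<in> X"
      have \<xi>_in: "\<xi> i \<omega> \<in> space P\<^sub>0" for i using measurable_space[OF \<xi> \<omega>] .
      define V where "V = variance_under (Q n \<omega>) (l x)"
      define w where "w = sqrt (real n)"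
      have w: "0 < w" "real n = w * w" using n by (simp_all add: w_def)
      have "\<bar>l x (\<xi> i \<omega>)\<bar> \<le> \<kappa> * w" if "i < n" for i
      proof -
        have "\<not> \<kappa> * w < \<bar>H (\<xi> i \<omega>)\<bar>" using good(2) \<omega> that by (auto simp: B_def w_def)
        then show ?thesis using l_le[OF x \<xi>_in[of i]] by linarith
      qed
      from \<delta>[OF n \<omega> x this]
      have "\<bar>\<epsilon> n x \<omega>\<bar> \<le> 2 * \<eta> * sqrt (\<rho> / n * V) + 2 * (2 * (\<kappa> * w)) * (\<rho> / n) / \<delta>"
        by (simp add: V_def)
      then have "w * \<bar>\<epsilon> n x \<omega>\<bar> \<le> w * (2 * \<eta> * sqrt (\<rho> / n * V) + 2 * (2 * (\<kappa> * w)) * (\<rho> / n) / \<delta>)"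
        using w by (intro mult_left_mono) auto
      \<comment> \<open>The scaling \<open>w\<close> and the bound \<open>\<kappa> * w\<close> on
        the samples together cancel the \<open>n\<close> in the radius.\<close>
      also have "\<dots> = 2 * \<eta> * (w * sqrt (\<rho> / n * V)) + 4 * \<kappa> * \<rho> / \<delta>"
        using w \<open>0 < \<delta>\<close> by (simp add: field_simps)
      also have "w * sqrt (\<rho> / n * V) = sqrt (\<rho> * V)"
        using n by (simp add: w_def flip: real_sqrt_mult)
      also have "2 * \<eta> * sqrt (\<rho> * V) \<le> 2 * \<eta> * sqrt (\<rho> * a)"
      proof -
        have "V \<le> (\<Sum>i<n. (H (\<xi> i \<omega>))\<^sup>2) / n"
          unfolding V_def Q_def
          by (rule variance_under_empirical_le) (use n \<xi>_in assms(4)[OF x] l_le[OF x] in auto)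
        also have "\<dots> \<le> a" using good(1) \<omega> by (simp add: A_def)
        finally show ?thesis using \<eta> \<open>\<rho> > 0\<close> by simp
      qed
      also have "4 * \<kappa> * \<rho> / \<delta> = \<tau> / 2"
        using \<open>0 < \<delta>\<close> \<open>\<rho> > 0\<close> by (simp add: \<kappa>_def)
      finally show "ereal (sqrt (real n) * \<bar>\<epsilon> n x \<omega>\<bar>) \<le> ereal \<tau>"
        using \<eta>_le by (simp add: w_def)
    qed
    then have "\<omega> \<in> A a n \<union> B \<kappa> n"
      if "1 \<le> n" "\<omega> \<in> space \<Omega>" "ereal \<tau> < (SUP x\<in>X. ereal (sqrt (real n) * \<bar>\<epsilon> n x \<omega>\<bar>))" for n \<omega>
      using that by (meson UnCI leD)
    then show ?thesis using \<open>0 < \<kappa>\<close> by (intro exI[of _ \<kappa>]) auto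
  qed
  have "tendsto_zero_in_outer_prob \<Omega> (\<lambda>n \<omega>. SUP x\<in>X. ereal (sqrt (real n) * \<bar>\<epsilon> n x \<omega>\<bar>))"
    unfolding tendsto_zero_in_outer_prob_def
  proof (intro allI impI order_tendstoI)
    fix \<tau> :: real and e :: ennreal assume "0 < \<tau>" "0 < e"
    \<comment> \<open>The tolerance \<open>e\<close> may be infinite, so a positive real below it is
      used instead.\<close>
    obtain e' where "0 < e'" and e': "ennreal e' < e"
    proof -
      obtain c where "0 < c" "c < e" using dense \<open>0 < e\<close> by blast
      then show thesis using that by (cases c) auto
    qed
    \<comment> \<open>Markov's inequality then gives \<open>A a n\<close> probability at most
      \<open>e' / 2\<close>; the summand 1 keeps \<open>a\<close> positive even if the second moment
      of \<open>H\<close> is 0.\<close>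
    define a where "a = 2 * (\<integral>z. (H z)\<^sup>2 \<partial>P\<^sub>0) / e' + 1"
    have E: "0 \<le> (\<integral>z. (H z)\<^sup>2 \<partial>P\<^sub>0)" by simp
    then have a: "0 < a" using \<open>0 < e'\<close> by (simp add: a_def add_nonneg_pos)
    have "2 * (\<integral>z. (H z)\<^sup>2 \<partial>P\<^sub>0) / e' \<le> a" by (simp add: a_def)
    then have a_le: "(\<integral>z. (H z)\<^sup>2 \<partial>P\<^sub>0) / a \<le> e' / 2" using \<open>0 < e'\<close> a by (simp add: field_simps)
    obtain \<kappa> where "0 < \<kappa>" and \<kappa>: "\<And>n. 1 \<le> n \<Longrightarrow>
      {\<omega> \<in> space \<Omega>. ereal \<tau> < (SUP x\<in>X. ereal (sqrt (real n) * \<bar>\<epsilon> n x \<omega>\<bar>))} \<subseteq> A a n \<union> B \<kappa> n"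
      using bad[OF \<open>0 < \<tau>\<close> a] by blast
    have "(\<lambda>n. measure \<Omega> (B \<kappa> n)) \<longlonglongrightarrow> 0"
      unfolding B_def by (rule tendsto_prob_max_gt[where \<xi> = \<xi>, OF tails \<open>0 < \<kappa>\<close>])
    then have "\<forall>\<^sub>F n in sequentially. measure \<Omega> (B \<kappa> n) < e' / 2"
      using \<open>0 < e'\<close> by (intro order_tendstoD) auto
    then show "\<forall>\<^sub>F n in sequentially.
      outer_measure_of \<Omega> {\<omega> \<in> space \<Omega>. ereal \<tau> < (SUP x\<in>X. ereal (sqrt (real n) * \<bar>\<epsilon> n x \<omega>\<bar>))} < e"
      using eventually_ge_at_top[of 1]
    proof eventually_elim
      case (elim n)
      have "outer_measure_of \<Omega> {\<omega> \<in> space \<Omega>. ereal \<tau> < (SUP x\<in>X. ereal (sqrt (real n) * \<bar>\<epsilon> n x \<omega>\<bar>))}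
          \<le> emeasure \<Omega> (A a n \<union> B \<kappa> n)"
        using outer_measure_of_mono[OF \<kappa>[OF elim(2)], of \<Omega>] by simp
      also have "\<dots> = ennreal (measure \<Omega> (A a n \<union> B \<kappa> n))" by (simp add: \<Omega>.emeasure_eq_measure)
      also have "\<dots> \<le> ennreal e'"
      proof (rule ennreal_leI)
        have "measure \<Omega> (A a n \<union> B \<kappa> n) \<le> measure \<Omega> (A a n) + measure \<Omega> (B \<kappa> n)"
          by (intro measure_Un_le) auto
        moreover have "measure \<Omega> (A a n) \<le> e' / 2"
          using prob_mean_square_ge[where \<xi> = \<xi>, OF tails a elim(2)] a_le unfolding A_def by (rule order_trans)
        ultimately show "measure \<Omega> (A a n \<union> B \<kappa> n) \<le> e'" using elim(1) by linarith
      qed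
      finally show ?case using e' by (rule le_less_trans)
    qed
  \<comment> \<open>The other half of \<open>order_tendstoI\<close> concerns bounds below 0, which
    do not exist in \<open>ennreal\<close>.\<close>
  qed (drule not_less_zero[THEN notE], assumption)
  then show ?thesis
    unfolding Let_def
    by (intro exI[of _ \<epsilon>] conjI allI impI ballI) (rule eq[unfolded S_def Q_def])
qed

end
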